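(* Let $A\in\mathbb{R}^{N\times N}$ and $\hat A\in\mathbb{R}^{n\times n}$ both be Hurwitz, and let $C\in\mathbb{R}^{p\times N}$, $\hat C\in\mathbb{R}^{p\times n}$, $W\in\mathbb{R}^{N\times n}$. Let $Q\in\mathbb{R}^{N\times N}$, $\mathring{Q}\in\mathbb{R}^{N\times n}$, $\hat Q\in\mathbb{R}^{n\times n}$ be the (unique) solutions of $$A^TQ+QA=-C^TC,\qquad A^T\mathring{Q}+\mathring{Q}\hat A=C^T\hat C,\qquad \hat A^T\hat Q+\hat Q\hat A=-\hat C^T\hat C.$$ Let $U\in\mathbb{R}^{m\times N}$ with $m\le N$ (so that $U^TU$ serves as an approximation of $Q$). For $x_0\in\mathbb{R}^N$ let $y_{x_0}$ and $\hat y_{x_0}$ be the outputs of the uncontrolled full and reduced systems $$\dot z(t)=Az(t),\quad z(0)=x_0,\quad y_{x_0}(t)=Cz(t),\qquad\qquad \dot{\hat z}(t)=\hat A\hat z(t),\quad \hat z(0)=W^Tx_0,\quad \hat y_{x_0}(t)=\hat C\hat z(t),\qquad t\ge 0,$$ and set $$\Delta_{x_0}^2=\|Ux_0\|^2+2x_0^T\mathring{Q}W^Tx_0+x_0^TW\hat QW^Tx_0\in\mathbb{R}.$$ Then for every $x_0\in\mathbb{R}^N$ $$\|y_{x_0}-\hat y_{x_0}\|_{\mathcal L^2}=\sqrt{\Delta_{x_0}^2+x_0^T(Q-U^TU)x_0}\;\le\;\sqrt{\Delta_{x_0}^2+\|Q-U^TU\|_2\,\|x_0\|^2}.$$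
   Context: A real square matrix is Hurwitz if all its eigenvalues have strictly negative real part. $\|\cdot\|$ is the Euclidean vector norm, $\|\cdot\|_2$ the spectral norm (the induced matrix 2-norm), and $\|y\|_{\mathcal L^2}=\left(\int_0^\infty\|y(t)\|^2\,dt\right)^{1/2}$. The symbol $\Delta_{x_0}^2$ denotes the displayed real number, which is not a priori claimed to be nonnegative for a general $U$; the error estimator is $\Delta_{x_0}=\sqrt{\Delta_{x_0}^2}$. *)

theory Defs
  imports "HOL-Analysis.Analysis"
begin

text \<open>The eigenvalues of a real matrix are those of its complexification.\<close>

definition complex_eigenvalue :: "real^'n^'n \<Rightarrow> complex \<Rightarrow> bool" where
  "complex_eigenvalue A l \<longleftrightarrow>
     (\<exists>v :: complex^'n. v \<noteq> 0 \<and> map_matrix complex_of_real A *v v = l *s v)"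

definition Hurwitz :: "real^'n^'n \<Rightarrow> bool" where
  "Hurwitz A \<longleftrightarrow> (\<forall>l. complex_eigenvalue A l \<longrightarrow> Re l < 0)"

definition spectral_norm :: "real^'n^'m \<Rightarrow> real" where
  "spectral_norm M = onorm ((*v) M)"

text \<open>\<open>y\<close> is the output of \<open>z' = A z\<close>, \<open>z 0 = z0\<close>, \<open>y = C z\<close> on \<open>[0, \<infinity>)\<close>; the derivative at \<open>0\<close> is
  one-sided, and the values of \<open>y\<close> at negative times are unconstrained.\<close>

definition uncontrolled_output ::
    "real^'n^'n \<Rightarrow> real^'n^'p \<Rightarrow> real^'n \<Rightarrow> (real \<Rightarrow> real^'p) \<Rightarrow> bool" where
  "uncontrolled_output A C z0 y \<longleftrightarrow>
     (\<exists>z :: real \<Rightarrow> real^'n.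
        z 0 = z0 \<and>
        (\<forall>t\<ge>0. (z has_vector_derivative A *v z t) (at t within {0..})) \<and>
        (\<forall>t\<ge>0. y t = C *v z t))"

text \<open>The Bochner integral is \<open>0\<close> for non-integrable functions, so \<open>L2_norm y\<close> is meaningful only
  for \<open>y\<close> with \<open>square_integrable y\<close>.\<close>

definition square_integrable :: "(real \<Rightarrow> 'a::real_normed_vector) \<Rightarrow> bool" where
  "square_integrable y \<longleftrightarrow> set_integrable lborel {0..} (\<lambda>t. (norm (y t))\<^sup>2)"

definition L2_norm :: "(real \<Rightarrow> 'a::real_normed_vector) \<Rightarrow> real" where
  "L2_norm y = sqrt (LINT t:{0..}|lborel. (norm (y t))\<^sup>2)"

text \<open>The number written \<open>\<Delta>\<^sup>2\<close>; it may be negative. \<open>Qo\<close> is the solution of the mixed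
  (Sylvester) equation.\<close>

definition Delta_sq ::
    "real^'N^'m \<Rightarrow> real^'n^'N \<Rightarrow> real^'n^'N \<Rightarrow> real^'n^'n \<Rightarrow> real^'N \<Rightarrow> real" where
  "Delta_sq U W Qo Qhat x0 =
     (norm (U *v x0))\<^sup>2
     + 2 * (x0 \<bullet> ((Qo ** transpose W) *v x0))
     + x0 \<bullet> ((W ** Qhat ** transpose W) *v x0)"

end

theory Submission
  imports Defs "HOL-Computational_Algebra.Fundamental_Theorem_Algebra"
begin

text \<open>Along the two trajectories \<open>z\<close> and \<open>h\<close>, the Sylvester equations say exactly that
  \<open>V = z\<^sup>T Q z + 2 z\<^sup>T Qo h + h\<^sup>T Qhat h\<close> satisfies \<open>V' = - \<parallel>C z - Chat h\<parallel>\<^sup>2\<close>. Both trajectories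
  tend to \<open>0\<close>, so the squared \<open>L2\<close> norm of the output error is \<open>V 0\<close>.

  That Hurwitz systems decay is shown without matrix exponentials: a polynomial \<open>p\<close> annihilates
  the initial value \<open>w 0\<close>; if \<open>p = (X - l) q\<close>, then either \<open>q\<close> already annihilates \<open>w 0\<close>, or \<open>l\<close> is an
  eigenvalue and \<open>u = (M - l) w\<close> is a solution whose initial value \<open>q\<close> annihilates. In the latter
  case \<open>u\<close> decays by induction, and \<open>w' = l w + u\<close> with \<open>Re l < 0\<close> makes \<open>w\<close> decay.\<close>

section \<open>Polynomials in a matrix, applied to a vector\<close>

definition poly_mat_vec :: "'a::field poly \<Rightarrow> 'a^'n^'n \<Rightarrow> 'a^'n \<Rightarrow> 'a^'n" where
  "poly_mat_vec p M v = (\<Sum>i\<le>degree p. coeff p i *s (((*v) M ^^ i) v))"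

text \<open>The degree of \<open>pCons a p\<close> behaves irregularly at \<open>p = 0\<close>; a
  free upper bound on the summation index avoids that case split.\<close>

lemma poly_mat_vec_altdef:
  assumes "degree p \<le> n"
  shows "poly_mat_vec p M v = (\<Sum>i\<le>n. coeff p i *s (((*v) M ^^ i) v))"
  unfolding poly_mat_vec_def
  by (rule sum.mono_neutral_left) (use assms in \<open>auto simp: coeff_eq_0\<close>)

text \<open>This is Horner's scheme with \<open>M\<close> pushed into the vector; it permits
  induction on \<open>p\<close> with the vector left arbitrary.\<close>

lemma poly_mat_vec_pCons:
  "poly_mat_vec (pCons a p) M v = a *s v + poly_mat_vec p M (M *v v)"
proof -
  have "poly_mat_vec (pCons a p) M v
      = (\<Sum>i\<le>Suc (degree p). coeff (pCons a p) i *s (((*v) M ^^ i) v))"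
    by (rule poly_mat_vec_altdef) (rule degree_pCons_le)
  also have "\<dots> = a *s v + (\<Sum>i\<le>degree p. coeff p i *s (((*v) M ^^ i) (M *v v)))"
    by (subst sum.atMost_Suc_shift) (simp add: funpow_swap1)
  finally show ?thesis by (simp add: poly_mat_vec_def)
qed

lemma poly_mat_vec_0 [simp]: "poly_mat_vec 0 M v = 0"
  by (simp add: poly_mat_vec_def)

lemma poly_mat_vec_diff: "poly_mat_vec p M (v - w) = poly_mat_vec p M v - poly_mat_vec p M w"
  by (induction p arbitrary: v w)
     (simp_all add: poly_mat_vec_pCons matrix_vector_mult_diff_distrib vec.scale_right_diff_distrib)

lemma poly_mat_vec_scale: "poly_mat_vec p M (c *s v) = c *s poly_mat_vec p M v"
  by (induction p arbitrary: v)
     (simp_all add: poly_mat_vec_pCons vector_scalar_commute vec.scale_right_distrib mult.commute)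

lemma poly_mat_vec_commute: "poly_mat_vec p M (M *v v) = M *v poly_mat_vec p M v"
  by (induction p arbitrary: v)
     (simp_all add: poly_mat_vec_pCons vector_scalar_commute matrix_vector_right_distrib)

text \<open>Polynomials in \<open>M\<close> commute, so the factor \<open>M - l\<close> may act
  first. A linear factor thus moves from the polynomial to the vector.\<close>

lemma poly_mat_vec_mult_linear_factor:
  "poly_mat_vec ([:-l, 1:] * q) M v = poly_mat_vec q M (M *v v - l *s v)"
proof (induction q arbitrary: v)
  case (pCons a q)
  have *: "[:-l, 1:] * pCons a q = pCons (- l * a) (pCons a 0 + [:-l, 1:] * q)"
    by (simp add: algebra_simps)
  have add_const: "poly_mat_vec (pCons b 0 + p) M w = b *s w + poly_mat_vec p M w" for b p w
    by (cases p) (simp add: poly_mat_vec_pCons vec.scale_left_distrib add.assoc)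
  show ?case
    unfolding * poly_mat_vec_pCons add_const pCons.IH
    by (simp add: poly_mat_vec_diff poly_mat_vec_scale algebra_simps vector_scalar_commute vec.scale_right_diff_distrib)
qed simp

text \<open>The first \<open>CARD('n) + 1\<close> iterates of \<open>v\<close> lie in a space of
  dimension \<open>CARD('n)\<close>, hence are linearly dependent; the coefficients of a dependency
  form \<open>p\<close>.\<close>

lemma exists_annihilating_poly:
  fixes M :: "'a::field^'n^'n"
  obtains p where "p \<noteq> 0" "poly_mat_vec p M v = 0"
proof -
  let ?f = "\<lambda>i. ((*v) M ^^ i) v"
  let ?n = "CARD('n)"
  obtain c :: "nat \<Rightarrow> 'a" where c: "(\<Sum>i\<le>?n. c i *s ?f i) = 0" "\<exists>i\<le>?n. c i \<noteq> 0"
  \<comment> \<open>Dependence is a property of a set of vectors, so repeated iterates are treated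
    separately, with coefficients 1 and -1 at a coincidence.\<close>
  proof (cases "inj_on ?f {..?n}")
    case True
    have "vec.dim (?f ` {..?n}) \<le> ?n"
      using vec.dim_subset[of "?f ` {..?n}" UNIV] by (simp only: vec_dim_card subset_UNIV)
    then have "card (?f ` {..?n}) > vec.dim (?f ` {..?n})"
      by (simp add: card_image[OF True])
    then have "vec.dependent (?f ` {..?n})"
      by (intro vec.dependent_biggerset_general)
    then obtain u where u: "\<exists>w\<in>?f ` {..?n}. u w \<noteq> 0" "(\<Sum>w\<in>?f ` {..?n}. u w *s w) = 0"
      by (auto simp: vec.dependent_finite)
    show ?thesis
      using u by (intro that[of "\<lambda>i. u (?f i)"]) (auto simp: sum.reindex[OF True])
  next
    case False
    then obtain i j where ij: "i \<le> ?n" "j \<le> ?n" "i \<noteq> j" "?f i = ?f j"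
      by (auto simp: inj_on_def)
    let ?c = "\<lambda>k. if k = i then 1 else if k = j then -1 else (0::'a)"
    have "(\<Sum>k\<le>?n. ?c k *s ?f k) = (\<Sum>k\<in>{i,j}. ?c k *s ?f k)"
      using ij by (intro sum.mono_neutral_right) auto
    then have "(\<Sum>k\<le>?n. ?c k *s ?f k) = 0"
      using ij by simp
    then show ?thesis
      using ij by (intro that[of ?c]) auto
  qed
  define p where "p = Poly (map c [0..<Suc ?n])"
  have coeff: "coeff p i = c i" if "i \<le> ?n" for i
    using that unfolding p_def coeff_Poly_eq
    by (simp add: nth_default_nth nth_append del: upt_Suc)
  have "degree p \<le> ?n"
  proof (rule degree_le, safe)
    fix i assume "?n < i"
    then show "coeff p i = 0"
      unfolding p_def coeff_Poly_eq by (simp add: nth_default_beyond del: upt_Suc)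
  qed
  then have "poly_mat_vec p M v = 0"
    using c(1) coeff by (simp add: poly_mat_vec_altdef)
  moreover have "p \<noteq> 0"
    using c(2) coeff by (metis coeff_0)
  ultimately show ?thesis
    using that by blast
qed

section \<open>Exponential decay for linear differential equations\<close>

text \<open>The strict gap between \<open>c\<close> and \<open>- Re l\<close> excludes resonance:
  the perturbation contributes a constant divided by the gap, without a factor
  \<open>t\<close>.\<close>

lemma perturbed_scalar_ode_bound:
  fixes f u :: "real \<Rightarrow> complex"
  assumes f': "\<And>t. t \<ge> 0 \<Longrightarrow> (f has_vector_derivative l * f t + u t) (at t within {0..})"
    and u: "\<And>t. t \<ge> 0 \<Longrightarrow> norm (u t) \<le> K * exp (- c * t)"
    and c: "c < - Re l" and t: "t \<ge> 0"
  shows "norm (f t) \<le> (norm (f 0) + K / (- Re l - c)) * exp (- c * t)"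
proof -
  define m where "m = - Re l - c"
  have "m > 0" using c by (simp add: m_def)
  have "K \<ge> 0"
    using order_trans[OF norm_ge_zero u[of 0]] by simp
  let ?e = "\<lambda>t. exp (- l * of_real t)"
  let ?g = "\<lambda>t. ?e t * f t"
  \<comment> \<open>Variation of constants: \<open>g' = exp (- l t) u\<close> is bounded by \<open>\<phi>'\<close>.\<close>
  let ?\<phi> = "\<lambda>t. K / m * exp (m * t)"
  have norm_e: "norm (?e s) = exp (- Re l * s)" for s
    by simp
  have e': "(?e has_vector_derivative - l * ?e s) (at s within S)" for s S
    by (rule has_vector_derivative_eq_rhs, rule has_vector_derivative_real_field)
       (auto intro!: derivative_eq_intros)
  have g': "(?g has_vector_derivative ?e s * u s) (at s within {0..})" if "s \<ge> 0" for s
    by (rule has_vector_derivative_eq_rhs[OF has_vector_derivative_mult[OF e' f'[OF that]]])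
       (simp add: algebra_simps)
  have "norm (?g t - ?g 0) \<le> ?\<phi> t - ?\<phi> 0"
  proof (cases "t = 0")
    case False
    show ?thesis
    proof (rule differentiable_bound_general)
      show "0 < t" using t False by simp
      show "continuous_on {0..t} ?g"
        by (rule continuous_on_vector_derivative[of _ _ "\<lambda>s. ?e s * u s"])
           (rule has_vector_derivative_within_subset[OF g'], auto)
      show "continuous_on {0..t} ?\<phi>"
        by (intro continuous_intros)
      show "(?g has_vector_derivative ?e s * u s) (at s)" if "0 < s" "s < t" for s
        using g'[of s] that at_within_interior[of s "{0..}"] by simp
      show "(?\<phi> has_vector_derivative K * exp (m * s)) (at s)" for s
        using \<open>m > 0\<close> unfolding has_real_derivative_iff_has_vector_derivative[symmetric]
        by (auto intro!: derivative_eq_intros)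
      show "norm (?e s * u s) \<le> K * exp (m * s)" if "0 < s" for s
      proof -
        have "norm (?e s * u s) \<le> exp (- Re l * s) * (K * exp (- c * s))"
          unfolding norm_mult norm_e using u[of s] that by (intro mult_left_mono) auto
        also have "\<dots> = K * exp (m * s)"
          by (simp add: m_def algebra_simps flip: exp_add)
        finally show ?thesis .
      qed
    qed
  qed simp
  then have "norm (?g t) \<le> norm (f 0) + ?\<phi> t - ?\<phi> 0"
    using norm_triangle_ineq2[of "?g t" "?g 0"] by simp
  \<comment> \<open>Since \<open>m > 0\<close>, the initial value can absorb a factor
    \<open>exp (m * t)\<close>; the nonnegative \<open>?\<phi> 0\<close> is dropped.\<close>
  also have "\<dots> \<le> norm (f 0) * exp (m * t) + ?\<phi> t"
  proof -
    have "0 \<le> K / m" using \<open>m > 0\<close> \<open>K \<ge> 0\<close> by simp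
    moreover have "norm (f 0) * 1 \<le> norm (f 0) * exp (m * t)"
      using \<open>m > 0\<close> t by (intro mult_left_mono) auto
    ultimately show ?thesis by (simp del: zero_le_divide_iff)
  qed
  finally have "norm (?g t) \<le> (norm (f 0) + K / m) * exp (m * t)"
    by (simp add: algebra_simps)
  then have le: "exp (Re l * t) * norm (?g t) \<le> exp (Re l * t) * ((norm (f 0) + K / m) * exp (m * t))"
    by (intro mult_left_mono) auto
  have "norm (f t) = exp (Re l * t) * norm (?g t)"
    unfolding norm_mult norm_e by (simp add: mult.assoc[symmetric] flip: exp_add)
  also note le
  also have "exp (Re l * t) * ((norm (f 0) + K / m) * exp (m * t))
      = (norm (f 0) + K / m) * exp (Re l * t + m * t)"
    by (simp only: exp_add mult_ac)
  also have "Re l * t + m * t = - c * t"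
    by (simp add: m_def algebra_simps)
  finally show ?thesis
    unfolding m_def .
qed

text \<open>A Gronwall argument: if \<open>B\<close> bounds \<open>L\<close>, then
  \<open>exp (- 2 * B * s) * (w s \<bullet> w s)\<close> is nonincreasing, and it starts at
  0.\<close>

lemma linear_ode_zero_unique:
  fixes w :: "real \<Rightarrow> 'a::real_inner"
  assumes L: "bounded_linear L"
    and w': "\<And>t. t \<ge> 0 \<Longrightarrow> (w has_vector_derivative L (w t)) (at t within {0..})"
    and "w 0 = 0" "t \<ge> 0"
  shows "w t = 0"
proof -
  obtain B where B: "\<And>x. norm (L x) \<le> norm x * B"
    using bounded_linear.bounded[OF L] by blast
  define \<phi> where "\<phi> s = exp (- 2 * B * s) * (w s \<bullet> w s)" for s
  define \<phi>' where "\<phi>' s = exp (- 2 * B * s) * (2 * (w s \<bullet> L (w s)) - 2 * B * (w s \<bullet> w s))" for s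
  have \<phi>': "(\<phi> has_real_derivative \<phi>' s) (at s within {0..})" if "s \<ge> 0" for s
    using w'[OF that] unfolding \<phi>_def \<phi>'_def has_vector_derivative_def has_field_derivative_def
    by (auto intro!: derivative_eq_intros simp: algebra_simps inner_commute fun_eq_iff)
  have "\<phi> t \<le> \<phi> 0"
  proof (rule DERIV_nonpos_imp_decreasing_open[OF \<open>t \<ge> 0\<close>])
    fix s assume s: "0 < s" "s < t"
    have "w s \<bullet> L (w s) \<le> norm (w s) * norm (L (w s))"
      by (rule norm_cauchy_schwarz)
    also have "\<dots> \<le> norm (w s) * (norm (w s) * B)"
      by (intro mult_left_mono B) auto
    finally have "\<phi>' s \<le> 0"
      by (simp add: \<phi>'_def mult_le_0_iff algebra_simps power2_norm_eq_inner[symmetric] power2_eq_square)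
    then show "\<exists>y. (\<phi> has_real_derivative y) (at s) \<and> y \<le> 0"
      using \<phi>'[of s] s at_within_interior[of s "{0..}"] by auto
  next
    show "continuous_on {0..t} \<phi>"
      by (rule DERIV_continuous_on[of _ _ \<phi>']) (auto intro: DERIV_subset[OF \<phi>'])
  qed
  also have "\<phi> 0 = 0"
    by (simp add: \<phi>_def \<open>w 0 = 0\<close>)
  finally have "w t \<bullet> w t \<le> 0"
    by (simp add: \<phi>_def mult_le_0_iff)
  then show ?thesis
    using inner_ge_zero[of "w t"] by (simp add: antisym)
qed

text \<open>The trajectory is generalised in the induction on the degree of \<open>p\<close>,
  because the step passes from \<open>w\<close> to another solution \<open>u\<close> of the same
  equation.\<close>

lemma linear_ode_exp_decay:
  fixes M :: "complex^'n^'n" and w :: "real \<Rightarrow> complex^'n"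
  assumes eig: "\<And>l v. v \<noteq> 0 \<Longrightarrow> M *v v = l *s v \<Longrightarrow> Re l < 0"
    and "\<And>t. t \<ge> 0 \<Longrightarrow> (w has_vector_derivative M *v w t) (at t within {0..})"
    and "p \<noteq> 0" "poly_mat_vec p M (w 0) = 0"
  shows "\<exists>c>0. \<exists>K. \<forall>t\<ge>0. \<forall>i. norm (w t $ i) \<le> K * exp (- c * t)"
  using assms(2-)
proof (induction "degree p" arbitrary: p w)
  case 0
  \<comment> \<open>A nonzero constant annihilates only the zero vector, so \<open>w\<close>
    vanishes by uniqueness; the rate 1 is an arbitrary choice.\<close>
  then obtain a where p: "p = [:a:]" "a \<noteq> 0"
    by (metis degree_eq_zeroE pCons_eq_0_iff)
  with 0 have "w 0 = 0"
    by (simp add: poly_mat_vec_pCons)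
  then show ?case
    using linear_ode_zero_unique[OF matrix_vector_mul_bounded_linear 0(2)]
    by (intro exI[of _ 1]) (auto intro!: exI[of _ 0])
next
  case (Suc d)
  have "\<not> constant (poly p)"
    using Suc.hyps(2) by (simp add: constant_degree)
  then obtain l where "poly p l = 0"
    using fundamental_theorem_of_algebra by blast
  then obtain q where p: "p = [:-l, 1:] * q"
    by (auto simp: poly_eq_0_iff_dvd)
  have "q \<noteq> 0" using p Suc.prems(2) by auto
  then have d: "d = degree q"
    using Suc.hyps(2) unfolding p by (subst (asm) degree_mult_eq) auto
  show ?case
  proof (cases "poly_mat_vec q M (w 0) = 0")
    case True
    then show ?thesis
      using Suc.hyps(1)[OF d Suc.prems(1) \<open>q \<noteq> 0\<close>] by blast
  next
    case False
    define u where "u t = M *v w t - l *s w t" for t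
    have q0: "poly_mat_vec q M (u 0) = 0"
      using Suc.prems(3) unfolding p poly_mat_vec_mult_linear_factor u_def .
    \<comment> \<open>Commuting \<open>M - l\<close> past \<open>q\<close> makes the nonzero vector
      \<open>poly_mat_vec q M (w 0)\<close> an eigenvector for \<open>l\<close>.\<close>
    then have "M *v poly_mat_vec q M (w 0) = l *s poly_mat_vec q M (w 0)"
      by (simp add: u_def poly_mat_vec_diff poly_mat_vec_scale poly_mat_vec_commute)
    with False eig have "Re l < 0" by blast
    have "bounded_linear (\<lambda>x :: complex^'n. l *s x)"
      unfolding linear_conv_bounded_linear[symmetric]
      by (auto intro!: linearI simp: vec_eq_iff algebra_simps)
    then have bl: "bounded_linear (\<lambda>x. M *v x - l *s x)"
      by (intro bounded_linear_sub matrix_vector_mul_bounded_linear)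
    have u': "(u has_vector_derivative M *v u t) (at t within {0..})" if "t \<ge> 0" for t
      using bounded_linear.has_vector_derivative[OF bl Suc.prems(1)[OF that]]
      by (simp add: u_def[abs_def] matrix_vector_mult_diff_distrib vector_scalar_commute)
    obtain c K where c: "c > 0"
      and K: "\<And>t i. t \<ge> 0 \<Longrightarrow> norm (u t $ i) \<le> K * exp (- c * t)"
      using Suc.hyps(1)[OF d u' \<open>q \<noteq> 0\<close> q0] by blast
    \<comment> \<open>The minimum keeps the bound on \<open>u\<close> valid at the new rate; halving
      \<open>- Re l\<close> keeps the rate strictly below it.\<close>
    define c' where "c' = min c (- Re l / 2)"
    have c': "c' > 0" "c' \<le> c" "c' < - Re l"
      using c \<open>Re l < 0\<close> by (auto simp: c'_def)
    have "norm (w t $ i) \<le> (norm (w 0) + K / (- Re l - c')) * exp (- c' * t)" if t: "t \<ge> 0" for t i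
    proof -
      have "norm (w t $ i) \<le> (norm (w 0 $ i) + K / (- Re l - c')) * exp (- c' * t)"
      proof (rule perturbed_scalar_ode_bound[OF _ _ c'(3) t])
        fix s :: real assume s: "s \<ge> 0"
        show "((\<lambda>t. w t $ i) has_vector_derivative l * w s $ i + u s $ i) (at s within {0..})"
          using bounded_linear.has_vector_derivative[OF bounded_linear_vec_nth Suc.prems(1)[OF s], of i]
          by (simp add: u_def)
        have "K \<ge> 0"
          using order_trans[OF norm_ge_zero K[of 0]] by simp
        have "norm (u s $ i) \<le> K * exp (- c * s)" by (rule K[OF s])
        also have "\<dots> \<le> K * exp (- c' * s)"
          using \<open>K \<ge> 0\<close> s c' by (intro mult_left_mono) (auto intro: mult_right_mono)
        finally show "norm (u s $ i) \<le> K * exp (- c' * s)" .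
      qed
      also have "\<dots> \<le> (norm (w 0) + K / (- Re l - c')) * exp (- c' * t)"
        by (intro mult_right_mono add_right_mono) (auto simp: Finite_Cartesian_Product.norm_nth_le)
      finally show ?thesis .
    qed
    then show ?thesis using c' by blast
  qed
qed

text \<open>Complexification makes the annihilating polynomial split and matches the definition of
  eigenvalues; the embedding preserves absolute values of components, so the decay carries
  back.\<close>

lemma Hurwitz_solution_tendsto_0:
  fixes A :: "real^'n^'n" and z :: "real \<Rightarrow> real^'n"
  assumes "Hurwitz A"
    and z': "\<And>t. t \<ge> 0 \<Longrightarrow> (z has_vector_derivative A *v z t) (at t within {0..})"
  shows "(z \<longlongrightarrow> 0) at_top"
proof -
  let ?M = "map_matrix complex_of_real A"
  let ?cv = "\<lambda>v :: real^'n. (\<chi> i. complex_of_real (v $ i)) :: complex^'n"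
  define w where "w t = ?cv (z t)" for t
  have cv: "bounded_linear ?cv"
    unfolding linear_conv_bounded_linear[symmetric]
    by (auto intro!: linearI simp: vec_eq_iff scaleR_conv_of_real[where 'a=complex])
  have "?cv (A *v v) = ?M *v ?cv v" for v
    by (simp add: vec_eq_iff matrix_vector_mult_def map_matrix_def)
  then have w': "(w has_vector_derivative ?M *v w t) (at t within {0..})" if "t \<ge> 0" for t
    using bounded_linear.has_vector_derivative[OF cv z'[OF that]] by (simp add: w_def[abs_def])
  obtain p where p: "p \<noteq> 0" "poly_mat_vec p ?M (w 0) = 0"
    by (rule exists_annihilating_poly)
  have eig: "Re l < 0" if "v \<noteq> 0" "?M *v v = l *s v" for l v
    using \<open>Hurwitz A\<close> that unfolding Hurwitz_def complex_eigenvalue_def by blast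
  have "\<exists>c>0. \<exists>K. \<forall>t\<ge>0. \<forall>i. norm (w t $ i) \<le> K * exp (- c * t)"
    by (rule linear_ode_exp_decay[OF _ w' p]) (rule eig)
  then obtain c K where c: "c > 0"
    and K: "\<And>t i. t \<ge> 0 \<Longrightarrow> norm (w t $ i) \<le> K * exp (- c * t)"
    by blast
  show ?thesis
  proof (rule vec_tendstoI)
    fix i
    have "((\<lambda>t. exp (- c * t)) \<longlongrightarrow> 0) at_top"
      using c by (intro filterlim_compose[OF exp_at_bot]
          filterlim_tendsto_neg_mult_at_bot[OF tendsto_const _ filterlim_ident]) auto
    then have lim: "((\<lambda>t. K * exp (- c * t)) \<longlongrightarrow> 0) at_top"
      by (rule tendsto_mult_right_zero)
    have "\<forall>\<^sub>F t in at_top. norm (z t $ i) \<le> K * exp (- c * t)"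
      using eventually_ge_at_top[of "0::real"]
      by eventually_elim (use K in \<open>auto simp: w_def\<close>)
    then have "((\<lambda>t. z t $ i) \<longlongrightarrow> 0) at_top"
      by (rule Lim_null_comparison[OF _ lim])
    then show "((\<lambda>t. z t $ i) \<longlongrightarrow> 0 $ i) at_top"
      by simp
  qed
qed

section \<open>Derivatives of bilinear forms and improper integrals\<close>

lemma inner_transpose_matrix_vector:
  fixes M :: "real^'n^'m"
  shows "x \<bullet> (transpose M *v y) = (M *v x) \<bullet> y"
  using dot_lmul_matrix[of y M x] by (simp only: transpose_matrix_vector inner_commute)

text \<open>If \<open>z' = A z\<close> and \<open>h' = B h\<close>, the left-hand side is the
  derivative of \<open>z \<bullet> (X *v h)\<close>; moving \<open>A\<close> across the inner
  product exposes the Sylvester equation.\<close>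

lemma Sylvester_inner:
  fixes X :: "real^'n^'m"
  assumes "transpose A ** X + X ** B = Y"
  shows "(A *v z) \<bullet> (X *v h) + z \<bullet> (X *v (B *v h)) = z \<bullet> (Y *v h)"
  unfolding assms[symmetric]
  by (simp add: matrix_vector_mult_add_rdistrib inner_add_right inner_transpose_matrix_vector
      matrix_vector_mul_assoc[symmetric] del: transpose_matrix_vector)

text \<open>For a nonnegative integrand, the limit of the antiderivative already yields
  integrability. The one-sided derivative gives right continuity of \<open>F\<close> at 0, and
  adding the null set \<open>{0}\<close> to the open half-line changes nothing.\<close>

lemma set_integral_FTC_Ici_nonneg:
  fixes f F :: "real \<Rightarrow> real"
  assumes F: "\<And>t. t \<ge> 0 \<Longrightarrow> (F has_real_derivative f t) (at t within {0..})"
    and f: "continuous_on {0..} f" and nonneg: "\<And>t. t \<ge> 0 \<Longrightarrow> f t \<ge> 0"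
    and L: "(F \<longlongrightarrow> L) at_top"
  shows "set_integrable lborel {0..} f" "(LINT t:{0..}|lborel. f t) = L - F 0"
proof -
  have at: "at t within {0..} = at t" if "t > 0" for t :: real
    using that at_within_interior[of t "{0..}"] by simp
  have e: "einterval 0 \<infinity> = {0<..}"
    by (auto simp: einterval_def zero_ereal_def)
  have F0: "((F \<circ> real_of_ereal) \<longlongrightarrow> F 0) (at_right 0)"
  proof -
    have "(F \<longlongrightarrow> F 0) (at_right 0)"
      using has_field_derivative_imp_has_derivative[OF F[of 0], THEN has_derivative_continuous]
      by (auto simp: continuous_within intro: tendsto_within_subset)
    then show ?thesis
      by (simp add: ereal_tendsto_simps zero_ereal_def)
  qed
  have F': "DERIV F t :> f t" if "t > 0" for t
    using F[of t] at[OF that] that by simp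
  have cont: "isCont f t" if "t > 0" for t
    using continuous_on_interior[OF f] that by simp
  have L': "((F \<circ> real_of_ereal) \<longlongrightarrow> L) (at_left \<infinity>)"
    using L by (simp add: ereal_tendsto_simps)
  have "set_integrable lborel (einterval 0 \<infinity>) f" "(LBINT t=0..\<infinity>. f t) = L - F 0"
    using interval_integral_FTC_nonneg[of 0 \<infinity> F f, OF _ _ _ _ F0 L'] F' cont nonneg
    by (auto simp: zero_ereal_def)
  then have I: "set_integrable lborel {0<..} f" "(LINT t:{0<..}|lborel. f t) = L - F 0"
    unfolding e by (simp_all add: interval_lebesgue_integral_def e)
  show "set_integrable lborel {0..} f"
    using I(1) by (subst set_integrable_discrete_difference[where X="{0}" and B="{0<..}"]) auto
  show "(LINT t:{0..}|lborel. f t) = L - F 0"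
    using I(2) by (subst set_integral_discrete_difference[where X="{0}" and B="{0<..}"]) auto
qed

section \<open>The energy of the output error\<close>

theorem theorem2:
  fixes A :: "real^'N^'N" and Ahat :: "real^'n^'n"
    and C :: "real^'N^'p" and Chat :: "real^'n^'p"
    and W :: "real^'n^'N"
    and Q :: "real^'N^'N" and Qo :: "real^'n^'N" and Qhat :: "real^'n^'n"
    and U :: "real^'N^'m"
    and x0 :: "real^'N"
    and y yhat :: "real \<Rightarrow> real^'p"
  assumes "Hurwitz A" and "Hurwitz Ahat"
    and "transpose A ** Q + Q ** A = - (transpose C ** C)"
    and "transpose A ** Qo + Qo ** Ahat = transpose C ** Chat"
    and "transpose Ahat ** Qhat + Qhat ** Ahat = - (transpose Chat ** Chat)"
    and "CARD('m) \<le> CARD('N)"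
    and "uncontrolled_output A C x0 y"
    and "uncontrolled_output Ahat Chat (transpose W *v x0) yhat"
  shows "square_integrable (\<lambda>t. y t - yhat t)
    \<and> L2_norm (\<lambda>t. y t - yhat t)
        = sqrt (Delta_sq U W Qo Qhat x0 + x0 \<bullet> ((Q - transpose U ** U) *v x0))
    \<and> sqrt (Delta_sq U W Qo Qhat x0 + x0 \<bullet> ((Q - transpose U ** U) *v x0))
        \<le> sqrt (Delta_sq U W Qo Qhat x0 + spectral_norm (Q - transpose U ** U) * (norm x0)\<^sup>2)"
proof -
  obtain z where z0: "z 0 = x0"
    and z': "\<And>t. t \<ge> 0 \<Longrightarrow> (z has_vector_derivative A *v z t) (at t within {0..})"
    and y: "\<And>t. t \<ge> 0 \<Longrightarrow> y t = C *v z t"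
    using assms(7) unfolding uncontrolled_output_def by blast
  obtain h where h0: "h 0 = transpose W *v x0"
    and h': "\<And>t. t \<ge> 0 \<Longrightarrow> (h has_vector_derivative Ahat *v h t) (at t within {0..})"
    and yhat: "\<And>t. t \<ge> 0 \<Longrightarrow> yhat t = Chat *v h t"
    using assms(8) unfolding uncontrolled_output_def by blast
  define f where "f t = (norm (C *v z t - Chat *v h t))\<^sup>2" for t
  \<comment> \<open>This is the quadratic form of the block matrix with blocks \<open>Q\<close>,
    \<open>Qo\<close>, \<open>transpose Qo\<close>, \<open>Qhat\<close>, which belongs to the error
    system with state \<open>(z, h)\<close> and output \<open>C z - Chat h\<close>.\<close>
  define V where "V t = z t \<bullet> (Q *v z t) + 2 * (z t \<bullet> (Qo *v h t)) + h t \<bullet> (Qhat *v h t)" for t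
  have V': "(V has_real_derivative - f t) (at t within {0..})" if "t \<ge> 0" for t
  proof -
    have mult: "((\<lambda>t. a t \<bullet> (X *v b t)) has_real_derivative
        a' \<bullet> (X *v b t) + a t \<bullet> (X *v b')) (at t within {0..})"
      if "(a has_vector_derivative a') (at t within {0..})"
         "(b has_vector_derivative b') (at t within {0..})"
      for a :: "real \<Rightarrow> real^'k" and b :: "real \<Rightarrow> real^'l" and X a' b'
      using bounded_bilinear.has_vector_derivative[OF bounded_bilinear_inner that(1)
          bounded_linear.has_vector_derivative[OF matrix_vector_mul_bounded_linear that(2), of X]]
      by (simp add: has_real_derivative_iff_has_vector_derivative add.commute)
    note deriv = mult[OF z'[OF that] z'[OF that], of Q] mult[OF z'[OF that] h'[OF that], of Qo]
      mult[OF h'[OF that] h'[OF that], of Qhat]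
    note [simp] = Sylvester_inner[OF assms(3)] Sylvester_inner[OF assms(4)] Sylvester_inner[OF assms(5)]
    have neg: "(- X) *v v = - (X *v v)" for X :: "real^'k^'k" and v
      by (simp add: vec_eq_iff matrix_vector_mult_def sum_negf)
    have "(V has_real_derivative z t \<bullet> (- (transpose C ** C) *v z t)
        + 2 * (z t \<bullet> ((transpose C ** Chat) *v h t))
        + h t \<bullet> (- (transpose Chat ** Chat) *v h t)) (at t within {0..})"
      unfolding V_def using deriv by (auto intro!: DERIV_add DERIV_cmult)
    \<comment> \<open>The three terms are the expansion of minus the squared norm of
      \<open>C *v z t - Chat *v h t\<close>.\<close>
    also have "z t \<bullet> (- (transpose C ** C) *v z t) + 2 * (z t \<bullet> ((transpose C ** Chat) *v h t))
        + h t \<bullet> (- (transpose Chat ** Chat) *v h t) = - f t"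
      by (simp add: f_def neg inner_transpose_matrix_vector power2_norm_eq_inner
          inner_diff_left inner_diff_right inner_commute matrix_vector_mul_assoc[symmetric]
          del: transpose_matrix_vector)
    finally show ?thesis .
  qed
  have cont: "continuous_on {0..} z" "continuous_on {0..} h"
    using z' h' by (auto intro!: continuous_on_vector_derivative)
  have f_cont: "continuous_on {0..} f"
    unfolding f_def
    by (intro continuous_intros cont matrix_vector_mult_linear_continuous_on
        bounded_linear.continuous_on[OF matrix_vector_mul_bounded_linear])
  have lim: "(z \<longlongrightarrow> 0) at_top" "(h \<longlongrightarrow> 0) at_top"
    using Hurwitz_solution_tendsto_0 assms(1,2) z' h' by blast+
  have mult_lim: "((\<lambda>t. X *v b t) \<longlongrightarrow> 0) at_top" if "(b \<longlongrightarrow> 0) at_top"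
    for X :: "real^'l^'k" and b :: "real \<Rightarrow> real^'l"
    using bounded_linear.tendsto[OF matrix_vector_mul_bounded_linear that, of X] by simp
  have V_lim: "((\<lambda>t. - V t) \<longlongrightarrow> 0) at_top"
    unfolding V_def
    by (auto intro!: tendsto_eq_intros lim mult_lim)
  \<comment> \<open>The antiderivative of \<open>f\<close> is \<open>- V\<close>, with limit 0, so
    the integral is \<open>0 - (- V 0)\<close>.\<close>
  have int: "set_integrable lborel {0..} f" "(LINT t:{0..}|lborel. f t) = V 0"
    using set_integral_FTC_Ici_nonneg[of "\<lambda>t. - V t" f 0, OF _ f_cont _ V_lim]
      DERIV_minus[OF V'] by (auto simp: f_def)
  have eq: "(norm (y t - yhat t))\<^sup>2 = f t" if "t \<in> {0..}" for t
    using that y yhat by (simp add: f_def)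
  \<comment> \<open>The term \<open>(norm (U *v x0))\<^sup>2\<close> in \<open>Delta_sq\<close>
    cancels against the \<open>transpose U ** U\<close> part, leaving the form of
    \<open>Q\<close>.\<close>
  have V0: "V 0 = Delta_sq U W Qo Qhat x0 + x0 \<bullet> ((Q - transpose U ** U) *v x0)"
    by (simp add: V_def Delta_sq_def z0 h0 matrix_vector_mult_diff_rdistrib inner_diff_right
        inner_transpose_matrix_vector power2_norm_eq_inner matrix_vector_mul_assoc[symmetric]
        del: transpose_matrix_vector)
       (metis inner_commute inner_transpose_matrix_vector transpose_transpose)
  have "square_integrable (\<lambda>t. y t - yhat t)"
    using int(1) eq unfolding square_integrable_def
    by (subst set_integrable_cong[OF refl refl eq]) auto
  moreover have "L2_norm (\<lambda>t. y t - yhat t) = sqrt (V 0)"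
    using int(2) eq unfolding L2_norm_def
    by (subst set_lebesgue_integral_cong[where g=f]) auto
  moreover have "x0 \<bullet> (X *v x0) \<le> spectral_norm X * (norm x0)\<^sup>2" for X :: "real^'N^'N"
  proof -
    have "x0 \<bullet> (X *v x0) \<le> norm x0 * norm (X *v x0)"
      by (rule norm_cauchy_schwarz)
    also have "\<dots> \<le> norm x0 * (spectral_norm X * norm x0)"
      unfolding spectral_norm_def
      by (intro mult_left_mono onorm matrix_vector_mul_bounded_linear) auto
    finally show ?thesis
      by (simp add: power2_eq_square mult_ac)
  qed
  \<comment> \<open>The real \<open>sqrt\<close> is monotone on all of the reals, so comparing the
    radicands suffices.\<close>
  ultimately show ?thesis
    by (simp add: V0)
qed

end
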